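(* Let $(G,\|\cdot\|_G)$ be a rearrangement invariant space over $(X,\Sigma,\mu)$, let $Y:T\times X\to\mathbb{R}$ be a separable function with $Y(t,\cdot)\in G$ for every $t\in T$, and let $\overline{Y}(x)=\sup_{t\in T}Y(t,x)$. Then $$\|\overline{Y}\|_G\le\inf_W\Lambda(T,G,W),$$ where the infimum is over all generic chainings $W=\{Q_k\}_{k\ge0}$ of $\tilde T$ and $$\Lambda(T,G,W)=\sum_{k=0}^{\infty}\left\|\max_{t\in Q_k}\bigl(Y(\pi_k(t),\cdot)-Y(\pi_{k-1}(t),\cdot)\bigr)\right\|_G,$$ with the convention $Y(\pi_{-1}(t),\cdot)=0$.
   Context: $(X,\Sigma,\mu)$ is a measure space with $\mu(X)=\infty$, $\mu$ $\sigma$-finite and diffuse (every $A\in\Sigma$ with $0<\mu(A)<\infty$ contains $B\in\Sigma$ with $\mu(B)=\mu(A)/2$). $T$ is an arbitrary non-empty set. For every $t\in T$ the function $x\mapsto Y(t,x)$ is measurable. Rearrangement invariant spaces are Banach function spaces in the standard sense. Put $d_G(t,s)=\|Y(t,\cdot)-Y(s,\cdot)\|_G$, a semi-distance on $T$. Separability of $Y$: there is a countable subset $\tilde T\subset T$ such that for every closed set $Q\subset\mathbb{R}$ the sets $\bigcap_{t\in\tilde T}\{x:Y(t,x)\in Q\}$ and $\bigcap_{t\in T}\{x:Y(t,x)\in Q\}$ are both measurable and their symmetric difference has $\mu$-measure zero. Here $\tilde T=\mathrm{sep}(T,d_G)$ is such a countable set that is moreover dense in $T$ with respect to $d_G$.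 A generic chaining $W=\{Q_k\}_{k\ge0}$ is a partition of $\tilde T$ into a sequence of finite subsets, $\tilde T=\bigcup_{k=0}^{\infty}Q_k$, with $Q_0=\{t_0\}$, where $t_0$ satisfies $\|Y(t_0,\cdot)\|_G=\sup_{t\in T}\|Y(t,\cdot)\|_G$. Given $W$, for each $t\in T$ and $k\ge0$, $\pi_k(t)$ denotes an arbitrary but fixed (not depending on $x$) element of $Q_k$ with $d_G(t,\pi_k(t))=\min_{s\in Q_k}d_G(t,s)$. *)

theory Defs
  imports "HOL-Analysis.Analysis"
begin

definition diffuse_measure :: "'a measure \<Rightarrow> bool" where
  "diffuse_measure M \<longleftrightarrow>
     (\<forall>A\<in>sets M. 0 < emeasure M A \<and> emeasure M A < \<infinity> \<longrightarrow>
        (\<exists>B\<in>sets M. B \<subseteq> A \<and> emeasure M B = emeasure M A / 2))"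

text \<open>
  Banach function norms in the sense of Bennett and Sharpley (properties P1 -- P5).
  The functional is only constrained on measurable functions with values in
  \<open>[0, \<infinity>]\<close>; its values elsewhere are irrelevant.
\<close>

locale banach_function_norm =
  fixes M :: "'a measure" and \<rho> :: "('a \<Rightarrow> ennreal) \<Rightarrow> ennreal"
  assumes eq_zero_iff:
      "f \<in> borel_measurable M \<Longrightarrow> \<rho> f = 0 \<longleftrightarrow> (AE x in M. f x = 0)"
    and scale:
      "f \<in> borel_measurable M \<Longrightarrow> 0 \<le> a \<Longrightarrow> \<rho> (\<lambda>x. ennreal a * f x) = ennreal a * \<rho> f"
    and triangle:
      "f \<in> borel_measurable M \<Longrightarrow> g \<in> borel_measurable M \<Longrightarrow> \<rho> (\<lambda>x. f x + g x) \<le> \<rho> f + \<rho> g"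
    and lattice:
      "f \<in> borel_measurable M \<Longrightarrow> g \<in> borel_measurable M \<Longrightarrow> (AE x in M. g x \<le> f x) \<Longrightarrow> \<rho> g \<le> \<rho> f"
    and fatou:
      "(\<And>n. F n \<in> borel_measurable M) \<Longrightarrow> f \<in> borel_measurable M \<Longrightarrow>
       (AE x in M. incseq (\<lambda>n. F n x) \<and> (\<lambda>n. F n x) \<longlonglongrightarrow> f x) \<Longrightarrow>
       incseq (\<lambda>n. \<rho> (F n)) \<and> (\<lambda>n. \<rho> (F n)) \<longlonglongrightarrow> \<rho> f"
    and indicator_finite:
      "E \<in> sets M \<Longrightarrow> emeasure M E < \<infinity> \<Longrightarrow> \<rho> (indicator E) < \<infinity>"
    and integral_bound:
      "E \<in> sets M \<Longrightarrow> emeasure M E < \<infinity> \<Longrightarrow>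
       \<exists>C::real. 0 < C \<and>
         (\<forall>f\<in>borel_measurable M. (\<integral>\<^sup>+x\<in>E. f x \<partial>M) \<le> ennreal C * \<rho> f)"

definition equimeasurable :: "'a measure \<Rightarrow> ('a \<Rightarrow> ennreal) \<Rightarrow> ('a \<Rightarrow> ennreal) \<Rightarrow> bool" where
  "equimeasurable M f g \<longleftrightarrow>
     (\<forall>l::real. 0 \<le> l \<longrightarrow>
        emeasure M {x\<in>space M. ennreal l < f x} = emeasure M {x\<in>space M. ennreal l < g x})"

locale rearrangement_invariant_norm = banach_function_norm +
  assumes rearrangement_invariant:
    "f \<in> borel_measurable M \<Longrightarrow> g \<in> borel_measurable M \<Longrightarrow>
     (AE x in M. f x < \<infinity>) \<Longrightarrow> (AE x in M. g x < \<infinity>) \<Longrightarrow>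
     equimeasurable M f g \<Longrightarrow> \<rho> f = \<rho> g"

text \<open>
  The norm is defined on extended real functions, because a supremum of infinitely many
  real functions may be infinite; it takes the value \<open>\<infinity>\<close> exactly off the space.
\<close>

definition fun_norm :: "(('a \<Rightarrow> ennreal) \<Rightarrow> ennreal) \<Rightarrow> ('a \<Rightarrow> ereal) \<Rightarrow> ennreal" where
  "fun_norm \<rho> f = \<rho> (\<lambda>x. e2ennreal \<bar>f x\<bar>)"

definition fun_space :: "'a measure \<Rightarrow> (('a \<Rightarrow> ennreal) \<Rightarrow> ennreal) \<Rightarrow> ('a \<Rightarrow> ereal) set" where
  "fun_space M \<rho> = {f \<in> borel_measurable M. fun_norm \<rho> f < \<infinity>}"

definition dG ::
    "(('a \<Rightarrow> ennreal) \<Rightarrow> ennreal) \<Rightarrow> ('t \<Rightarrow> 'a \<Rightarrow> real) \<Rightarrow> 't \<Rightarrow> 't \<Rightarrow> ennreal" where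
  "dG \<rho> Y t s = fun_norm \<rho> (\<lambda>x. ereal (Y t x - Y s x))"

definition separable_via ::
    "'a measure \<Rightarrow> 't set \<Rightarrow> ('t \<Rightarrow> 'a \<Rightarrow> real) \<Rightarrow> 't set \<Rightarrow> bool" where
  "separable_via M T Y S \<longleftrightarrow> countable S \<and> S \<subseteq> T \<and>
     (\<forall>Q::real set. closed Q \<longrightarrow>
        {x\<in>space M. \<forall>t\<in>S. Y t x \<in> Q} \<in> sets M \<and>
        {x\<in>space M. \<forall>t\<in>T. Y t x \<in> Q} \<in> sets M \<and>
        emeasure M (sym_diff {x\<in>space M. \<forall>t\<in>S. Y t x \<in> Q} {x\<in>space M. \<forall>t\<in>T. Y t x \<in> Q}) = 0)"

definition dense_wrt :: "('t \<Rightarrow> 't \<Rightarrow> ennreal) \<Rightarrow> 't set \<Rightarrow> 't set \<Rightarrow> bool" where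
  "dense_wrt d T S \<longleftrightarrow> S \<subseteq> T \<and> (\<forall>t\<in>T. \<forall>e>0. \<exists>s\<in>S. d t s < e)"

text \<open>
  If \<open>S\<close> is infinite, the last condition forces every block to be nonempty. If \<open>S\<close> is finite,
  the chaining consists of finitely many nonempty blocks, followed by empty ones.
\<close>

definition generic_chaining ::
    "(('a \<Rightarrow> ennreal) \<Rightarrow> ennreal) \<Rightarrow> 't set \<Rightarrow> ('t \<Rightarrow> 'a \<Rightarrow> real) \<Rightarrow> 't set \<Rightarrow> (nat \<Rightarrow> 't set) \<Rightarrow> bool"
  where
  "generic_chaining \<rho> T Y S Q \<longleftrightarrow>
     (\<forall>k. finite (Q k)) \<and> disjoint_family Q \<and> (\<Union>k. Q k) = S \<and>
     (\<exists>t0. Q 0 = {t0} \<and>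
        fun_norm \<rho> (\<lambda>x. ereal (Y t0 x)) = (SUP t\<in>T. fun_norm \<rho> (\<lambda>x. ereal (Y t x)))) \<and>
     (\<forall>k. Q k = {} \<longrightarrow> Q (Suc k) = {})"

definition nearest_selection ::
    "('t \<Rightarrow> 't \<Rightarrow> ennreal) \<Rightarrow> 't set \<Rightarrow> (nat \<Rightarrow> 't set) \<Rightarrow> (nat \<Rightarrow> 't \<Rightarrow> 't) \<Rightarrow> bool" where
  "nearest_selection d T Q p \<longleftrightarrow>
     (\<forall>t\<in>T. \<forall>k. Q k \<noteq> {} \<longrightarrow> p k t \<in> Q k \<and> d t (p k t) = (MIN s\<in>Q k. d t s))"

text \<open>Empty blocks contribute nothing to the sum.\<close>

definition chaining_sum ::
    "(('a \<Rightarrow> ennreal) \<Rightarrow> ennreal) \<Rightarrow> ('t \<Rightarrow> 'a \<Rightarrow> real) \<Rightarrow> (nat \<Rightarrow> 't set) \<Rightarrow> (nat \<Rightarrow> 't \<Rightarrow> 't) \<Rightarrow> ennreal"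
  where
  "chaining_sum \<rho> Y Q p =
     (\<Sum>k. if Q k = {} then 0
          else fun_norm \<rho> (\<lambda>x. ereal (MAX t\<in>Q k.
                 Y (p k t) x - (if k = 0 then 0 else Y (p (k - 1) t) x))))"

end

theory Submission
  imports Defs
begin

text \<open>
  Fix a chaining \<open>W\<close> and write \<open>Z k\<close> for the largest increment over the block \<open>W k\<close>. The inequality
  is the pointwise estimate \<open>\<bar>SUP t\<in>T. Y t x\<bar> \<le> (\<Sum>k. \<bar>Z k x\<bar>)\<close>, for almost every \<open>x\<close>, followed by
  countable subadditivity of the norm, which is the triangle inequality together with the Fatou
  property.

  For the pointwise estimate, separability tested on the half-lines \<open>{..q}\<close> with rational \<open>q\<close>
  replaces the supremum over \<open>T\<close> by the one over the countable set \<open>S\<close> of all links. A link \<open>t\<close>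
  in \<open>W m\<close> is its own nearest point in \<open>W m\<close> only up to distance zero, hence up to a null set;
  as \<open>S\<close> is countable, one null set serves all links. Off that set \<open>Y t x\<close> telescopes. Telescoping
  along the nearest points of the fixed \<open>t\<close> would produce increments at points outside
  the blocks, which \<open>Z k\<close> does not control. Instead the chain descends recursively: from \<open>t\<close> in
  \<open>W (Suc m)\<close> it passes to the nearest point of \<open>W m\<close>, and from there to the nearest point of the
  preceding block, so that each increment is taken at a point of its own block. This bounds the
  supremum from above. From below it is bounded by the value at the root \<open>t0\<close>, which is \<open>Z 0\<close>.
\<close>

section \<open>Countable subadditivity of a Banach function norm\<close>

context banach_function_norm
begin

lemma norm_zero: "\<rho> (\<lambda>x. 0) = 0"
  by (subst eq_zero_iff) auto

lemma norm_sum_le: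
  fixes n :: nat
  assumes "\<And>k. f k \<in> borel_measurable M"
  shows "\<rho> (\<lambda>x. \<Sum>k<n. f k x) \<le> (\<Sum>k<n. \<rho> (f k))"
proof (induction n)
  case 0
  show ?case by (simp add: norm_zero)
next
  case (Suc n)
  have "\<rho> (\<lambda>x. (\<Sum>k<n. f k x) + f n x) \<le> \<rho> (\<lambda>x. \<Sum>k<n. f k x) + \<rho> (f n)"
    using assms by (intro triangle) auto
  also have "\<dots> \<le> (\<Sum>k<n. \<rho> (f k)) + \<rho> (f n)"
    using Suc by (rule add_right_mono)
  finally show ?case by simp
qed

lemma norm_suminf_le:
  assumes f: "\<And>k. f k \<in> borel_measurable M"
  shows "\<rho> (\<lambda>x. \<Sum>k. f k x) \<le> (\<Sum>k. \<rho> (f k))"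
proof -
  have "(\<lambda>n. \<rho> (\<lambda>x. \<Sum>k<n. f k x)) \<longlonglongrightarrow> \<rho> (\<lambda>x. \<Sum>k. f k x)"
  proof (rule fatou[THEN conjunct2])
    show "AE x in M. incseq (\<lambda>n. \<Sum>k<n. f k x) \<and> (\<lambda>n. \<Sum>k<n. f k x) \<longlonglongrightarrow> (\<Sum>k. f k x)"
      by (intro AE_I2 conjI incseq_SucI summable_LIMSEQ) auto
  qed (use f in auto)
  then show ?thesis
  proof (rule LIMSEQ_le_const2)
    show "\<exists>N. \<forall>n\<ge>N. \<rho> (\<lambda>x. \<Sum>k<n. f k x) \<le> (\<Sum>k. \<rho> (f k))"
      by (intro exI allI impI order_trans[OF norm_sum_le] sum_le_suminf f) auto
  qed
qed

lemma dG_self: "dG \<rho> Y t t = 0"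
  by (simp add: dG_def fun_norm_def norm_zero)

lemma AE_eq_if_dG_zero:
  assumes "Y t \<in> borel_measurable M" "Y s \<in> borel_measurable M" "dG \<rho> Y t s = 0"
  shows "AE x in M. Y t x = Y s x"
proof -
  have "(\<lambda>x. ennreal \<bar>Y t x - Y s x\<bar>) \<in> borel_measurable M"
    using assms(1,2) by measurable
  moreover have "\<rho> (\<lambda>x. ennreal \<bar>Y t x - Y s x\<bar>) = 0"
    using assms(3) by (simp add: dG_def fun_norm_def)
  ultimately have "AE x in M. ennreal \<bar>Y t x - Y s x\<bar> = 0"
    using eq_zero_iff by blast
  then show ?thesis
    by eventually_elim (simp add: ennreal_eq_0_iff)
qed

text \<open>
  A minimiser of the distance to a point of \<open>Q k\<close> within \<open>Q k\<close> lies at distance zero, because the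
  point itself competes. It may be a different index, but with almost the same function.
\<close>

lemma AE_nearest_selection_fixes_block:
  assumes sel: "nearest_selection (dG \<rho> Y) T Q \<pi>"
    and Y: "\<And>t. t \<in> T \<Longrightarrow> Y t \<in> borel_measurable M"
    and Q: "finite (Q k)" "Q k \<subseteq> T" and t: "t \<in> Q k"
  shows "AE x in M. Y t x = Y (\<pi> k t) x"
proof (rule AE_eq_if_dG_zero)
  have near: "\<pi> k t \<in> Q k" "dG \<rho> Y t (\<pi> k t) = (MIN s\<in>Q k. dG \<rho> Y t s)"
    using sel t Q(2) unfolding nearest_selection_def by blast+
  show "Y t \<in> borel_measurable M" "Y (\<pi> k t) \<in> borel_measurable M"
    using Y Q(2) t near(1) by auto
  have "(MIN s\<in>Q k. dG \<rho> Y t s) \<le> dG \<rho> Y t t"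
    using Q(1) t by (intro Min_le) auto
  then show "dG \<rho> Y t (\<pi> k t) = 0"
    by (simp add: near(2) dG_self)
qed

end

section \<open>The supremum of a separable family\<close>

lemma borel_measurable_SUP_if_separable:
  assumes sep: "separable_via M T Y S" and "T \<noteq> {}"
  shows "(\<lambda>x. SUP t\<in>T. ereal (Y t x)) \<in> borel_measurable M"
proof (rule borel_measurableI_le)
  fix a :: ereal
  show "{x \<in> space M. (SUP t\<in>T. ereal (Y t x)) \<le> a} \<in> sets M"
  proof (cases a)
    case (real q)
    have "{x\<in>space M. \<forall>t\<in>T. Y t x \<in> {..q}} \<in> sets M"
      using sep[unfolded separable_via_def] closed_atMost[of q] by blast
    then show ?thesis
      by (simp add: real SUP_le_iff)
  next
    case MInf
    obtain t where "t \<in> T" using \<open>T \<noteq> {}\<close> by blast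
    then have "\<not> (SUP t\<in>T. ereal (Y t x)) \<le> a" for x
      unfolding MInf SUP_le_iff by auto
    then show ?thesis by simp
  qed simp
qed

lemma AE_SUP_eq_if_separable:
  assumes sep: "separable_via M T Y S"
  shows "AE x in M. (SUP t\<in>T. ereal (Y t x)) = (SUP t\<in>S. ereal (Y t x))"
proof -
  have "S \<subseteq> T" using sep unfolding separable_via_def by blast
  have "AE x in M. \<forall>q::rat. (\<forall>t\<in>S. Y t x \<le> of_rat q) \<longrightarrow> (\<forall>t\<in>T. Y t x \<le> of_rat q)"
  proof (rule AE_all_countable[THEN iffD2], rule allI)
    fix q :: rat
    let ?A = "\<lambda>U. {x\<in>space M. \<forall>t\<in>U. Y t x \<in> {..of_rat q}}"
    have "?A S \<in> sets M" "?A T \<in> sets M" "emeasure M (sym_diff (?A S) (?A T)) = 0"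
      using sep[unfolded separable_via_def] closed_atMost[of "of_rat q :: real"] by blast+
    then have "sym_diff (?A S) (?A T) \<in> null_sets M"
      by (intro null_setsI) auto
    then show "AE x in M. (\<forall>t\<in>S. Y t x \<le> of_rat q) \<longrightarrow> (\<forall>t\<in>T. Y t x \<le> of_rat q)"
      by (rule AE_I') auto
  qed
  then show ?thesis
  proof eventually_elim
    case (elim x)
    have "(SUP t\<in>T. ereal (Y t x)) \<le> (SUP t\<in>S. ereal (Y t x))"
    proof (rule ccontr)
      assume "\<not> ?thesis"
      then have "(SUP t\<in>S. ereal (Y t x)) < (SUP t\<in>T. ereal (Y t x))" by simp
      then obtain t where t: "t \<in> T" "(SUP t\<in>S. ereal (Y t x)) < ereal (Y t x)"
        by (auto simp: less_SUP_iff)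
      then obtain r where r: "(SUP t\<in>S. ereal (Y t x)) < ereal r" "r < Y t x"
        using ereal_dense2 less_ereal.simps(1) by blast
      obtain q where q: "r < of_rat q" "of_rat q < Y t x"
        using of_rat_dense[OF r(2)] by blast
      have "Y s x \<le> of_rat q" if "s \<in> S" for s
      proof -
        have "ereal (Y s x) < ereal r"
          using SUP_upper[OF that, of "\<lambda>s. ereal (Y s x)"] r(1) by (rule le_less_trans)
        then show ?thesis using q(1) by simp
      qed
      then show False using elim t(1) q(2) by fastforce
    qed
    moreover have "(SUP t\<in>S. ereal (Y t x)) \<le> (SUP t\<in>T. ereal (Y t x))"
      using \<open>S \<subseteq> T\<close> by (rule SUP_subset_mono) simp
    ultimately show ?case by (rule antisym)
  qed
qed

section \<open>Chaining along a recursive chain\<close>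

definition max_increment :: "('t \<Rightarrow> real) \<Rightarrow> (nat \<Rightarrow> 't set) \<Rightarrow> (nat \<Rightarrow> 't \<Rightarrow> 't) \<Rightarrow> nat \<Rightarrow> real" where
  "max_increment y Q \<pi> k = (MAX t\<in>Q k. y (\<pi> k t) - (if k = 0 then 0 else y (\<pi> (k - 1) t)))"

lemma max_increment_ge:
  assumes "finite (Q k)" "t \<in> Q k"
  shows "y (\<pi> k t) - (if k = 0 then 0 else y (\<pi> (k - 1) t)) \<le> max_increment y Q \<pi> k"
  unfolding max_increment_def using assms by (intro Max_ge) auto

text \<open>
  The induction hypothesis is applied at \<open>\<pi> m t\<close> and not at \<open>t\<close>: this is the recursive descent that
  keeps every increment at a point of the block over which its maximum is taken.
\<close>

lemma chaining_pointwise: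
  assumes fin: "\<And>k. finite (Q k)"
    and next_empty: "\<And>k. Q k = {} \<Longrightarrow> Q (Suc k) = {}"
    and \<pi>: "\<And>k j t. t \<in> Q j \<Longrightarrow> Q k \<noteq> {} \<Longrightarrow> \<pi> k t \<in> Q k"
    and fixed: "\<And>k t. t \<in> Q k \<Longrightarrow> y t = y (\<pi> k t)"
    and "t \<in> Q m"
  shows "y t \<le> (\<Sum>k\<le>m. max_increment y Q \<pi> k)"
  using \<open>t \<in> Q m\<close>
proof (induction m arbitrary: t)
  case 0
  then show ?case
    using max_increment_ge[of Q 0 t y \<pi>] fin fixed[of t 0] by simp
next
  case (Suc m)
  have "Q m \<noteq> {}" using next_empty Suc.prems by blast
  then have "\<pi> m t \<in> Q m" using \<pi> Suc.prems by blast
  then have "y (\<pi> m t) \<le> (\<Sum>k\<le>m. max_increment y Q \<pi> k)" by (rule Suc.IH)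
  moreover have "y t - y (\<pi> m t) \<le> max_increment y Q \<pi> (Suc m)"
    using max_increment_ge[of Q "Suc m" t y \<pi>] fin Suc.prems fixed[of t "Suc m"] by simp
  ultimately show ?case by simp
qed

text \<open>
  The maxima themselves may be negative, hence the absolute values. The first term of the series
  is \<open>\<bar>y t0\<bar>\<close>, and this bounds the supremum from below.
\<close>

lemma abs_SUP_le_chaining:
  assumes fin: "\<And>k. finite (Q k)"
    and root: "Q 0 = {t0}"
    and next_empty: "\<And>k. Q k = {} \<Longrightarrow> Q (Suc k) = {}"
    and \<pi>: "\<And>k j t. t \<in> Q j \<Longrightarrow> Q k \<noteq> {} \<Longrightarrow> \<pi> k t \<in> Q k"
    and fixed: "\<And>k t. t \<in> Q k \<Longrightarrow> y t = y (\<pi> k t)"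
  shows "e2ennreal \<bar>SUP t\<in>(\<Union>k. Q k). ereal (y t)\<bar>
    \<le> (\<Sum>k. if Q k = {} then 0 else ennreal \<bar>max_increment y Q \<pi> k\<bar>)"
    (is "_ \<le> (\<Sum>k. ?F k)")
proof -
  have upper: "ereal (y t) \<le> enn2ereal (\<Sum>k. ?F k)" if t: "t \<in> (\<Union>k. Q k)" for t
  proof -
    obtain m where m: "t \<in> Q m" using t by blast
    have nonempty: "Q k \<noteq> {}" if "k \<le> m" for k
      using that by (induction rule: inc_induct) (use m next_empty in auto)
    have "y t \<le> (\<Sum>k\<le>m. max_increment y Q \<pi> k)"
      using fin next_empty \<pi> fixed m by (rule chaining_pointwise)
    also have "\<dots> \<le> (\<Sum>k\<le>m. \<bar>max_increment y Q \<pi> k\<bar>)"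
      by (rule sum_mono) simp
    finally have "ereal (y t) \<le> enn2ereal (ennreal (\<Sum>k\<le>m. \<bar>max_increment y Q \<pi> k\<bar>))"
      by (simp add: sum_nonneg)
    also have "ennreal (\<Sum>k\<le>m. \<bar>max_increment y Q \<pi> k\<bar>) = (\<Sum>k\<le>m. ?F k)"
    proof -
      have "(\<Sum>k\<le>m. ?F k) = (\<Sum>k\<le>m. ennreal \<bar>max_increment y Q \<pi> k\<bar>)"
        by (rule sum.cong[OF refl]) (simp add: nonempty)
      then show ?thesis by simp
    qed
    also have "enn2ereal (\<Sum>k\<le>m. ?F k) \<le> enn2ereal (\<Sum>k. ?F k)"
      unfolding less_eq_ennreal.rep_eq[symmetric] by (rule sum_le_suminf) auto
    finally show ?thesis .
  qed
  have "y t0 = max_increment y Q \<pi> 0"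
    using fixed[of t0 0] root by (simp add: max_increment_def)
  then have "ennreal \<bar>y t0\<bar> = (\<Sum>k<1. ?F k)"
    using root by simp
  also have "\<dots> \<le> (\<Sum>k. ?F k)"
    by (rule sum_le_suminf) auto
  finally have root_le: "ereal \<bar>y t0\<bar> \<le> enn2ereal (\<Sum>k. ?F k)"
    unfolding less_eq_ennreal.rep_eq by simp
  have "- (SUP t\<in>(\<Union>k. Q k). ereal (y t)) \<le> - ereal (y t0)"
    using root by (subst ereal_minus_le_minus, intro SUP_upper) blast
  also have "\<dots> \<le> ereal \<bar>y t0\<bar>"
    by simp
  also note root_le
  finally have lower: "- (SUP t\<in>(\<Union>k. Q k). ereal (y t)) \<le> enn2ereal (\<Sum>k. ?F k)" .
  have "\<bar>SUP t\<in>(\<Union>k. Q k). ereal (y t)\<bar> \<le> enn2ereal (\<Sum>k. ?F k)"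
    by (intro ereal_abs_leI SUP_least upper lower)
  then have "e2ennreal \<bar>SUP t\<in>(\<Union>k. Q k). ereal (y t)\<bar> \<le> e2ennreal (enn2ereal (\<Sum>k. ?F k))"
    by (rule e2ennreal_mono)
  then show ?thesis by simp
qed

section \<open>The norm of the supremum\<close>

lemma (in banach_function_norm) norm_SUP_le_chaining_sum:
  assumes "T \<noteq> {}"
    and Y: "\<And>t. t \<in> T \<Longrightarrow> Y t \<in> borel_measurable M"
    and sep: "separable_via M T Y S"
    and W: "generic_chaining \<rho> T Y S Q"
    and sel: "nearest_selection (dG \<rho> Y) T Q \<pi>"
  shows "fun_norm \<rho> (\<lambda>x. SUP t\<in>T. ereal (Y t x)) \<le> chaining_sum \<rho> Y Q \<pi>"
proof -
  define F where "F k x = (if Q k = {} then 0 else ennreal \<bar>max_increment (\<lambda>t. Y t x) Q \<pi> k\<bar>)"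
    for k x
  have fin: "\<And>k. finite (Q k)" and S: "(\<Union>k. Q k) = S"
    and next_empty: "\<And>k. Q k = {} \<Longrightarrow> Q (Suc k) = {}"
    using W unfolding generic_chaining_def by blast+
  obtain t0 where root: "Q 0 = {t0}"
    using W unfolding generic_chaining_def by blast
  have "S \<subseteq> T" "countable S"
    using sep unfolding separable_via_def by blast+
  then have block: "Q k \<subseteq> T" for k using S by blast
  have \<pi>: "\<pi> k t \<in> Q k" if "t \<in> T" "Q k \<noteq> {}" for k t
    using sel that unfolding nearest_selection_def by blast

  have F_measurable: "F k \<in> borel_measurable M" for k
  proof (cases "Q k = {}")
    case False
    have "(\<lambda>x. Y (\<pi> k t) x - (if k = 0 then 0 else Y (\<pi> (k - 1) t) x)) \<in> borel_measurable M"
      if "t \<in> Q k" for t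
    proof -
      have "t \<in> T" using block that by blast
      then have "Y (\<pi> k t) \<in> borel_measurable M"
        using \<pi> False block Y by blast
      moreover have "Y (\<pi> (k - 1) t) \<in> borel_measurable M" if "k \<noteq> 0"
      proof -
        have "Q (k - 1) \<noteq> {}"
          using next_empty[of "k - 1"] False that by auto
        then show ?thesis
          using \<pi> \<open>t \<in> T\<close> block Y by blast
      qed
      ultimately show ?thesis by (cases "k = 0") auto
    qed
    then have "(\<lambda>x. max_increment (\<lambda>t. Y t x) Q \<pi> k) \<in> borel_measurable M"
      unfolding max_increment_def by (intro borel_measurable_Max fin) auto
    then show ?thesis
      using False unfolding F_def by simp
  qed (simp add: F_def[abs_def])

  have "AE x in M. \<forall>t\<in>S. \<forall>k. t \<in> Q k \<longrightarrow> Y t x = Y (\<pi> k t) x"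
    using \<open>countable S\<close>
    by (auto simp: AE_ball_countable AE_all_countable
        intro!: AE_impI AE_nearest_selection_fixes_block[OF sel Y fin block])
  with AE_SUP_eq_if_separable[OF sep]
  have "AE x in M. e2ennreal \<bar>SUP t\<in>T. ereal (Y t x)\<bar> \<le> (\<Sum>k. F k x)"
  proof eventually_elim
    case (elim x)
    have "e2ennreal \<bar>SUP t\<in>(\<Union>k. Q k). ereal (Y t x)\<bar> \<le> (\<Sum>k. F k x)"
      unfolding F_def
    proof (rule abs_SUP_le_chaining[OF fin root next_empty])
      show "\<pi> k t \<in> Q k" if "t \<in> Q j" "Q k \<noteq> {}" for k j t
        using \<pi> that block by blast
      show "Y t x = Y (\<pi> k t) x" if "t \<in> Q k" for k t
        using elim(2) S that by blast
    qed
    then show ?case using elim(1) S by simp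
  qed
  moreover have "(\<lambda>x. e2ennreal \<bar>SUP t\<in>T. ereal (Y t x)\<bar>) \<in> borel_measurable M"
    using borel_measurable_SUP_if_separable[OF sep \<open>T \<noteq> {}\<close>]
    by (intro measurable_compose[OF _ measurable_e2ennreal] borel_measurable_ereal_abs)
  ultimately have "fun_norm \<rho> (\<lambda>x. SUP t\<in>T. ereal (Y t x)) \<le> \<rho> (\<lambda>x. \<Sum>k. F k x)"
    unfolding fun_norm_def
    using F_measurable by (intro lattice) auto
  also have "\<dots> \<le> (\<Sum>k. \<rho> (F k))"
    using F_measurable by (rule norm_suminf_le)
  also have "(\<lambda>k. \<rho> (F k)) = (\<lambda>k. if Q k = {} then 0 else
      fun_norm \<rho> (\<lambda>x. ereal (max_increment (\<lambda>t. Y t x) Q \<pi> k)))"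
    by (auto simp: F_def[abs_def] fun_norm_def norm_zero)
  finally show ?thesis
    unfolding chaining_sum_def max_increment_def .
qed

theorem proposition2:
  fixes M :: "'a measure" and \<rho> :: "('a \<Rightarrow> ennreal) \<Rightarrow> ennreal"
    and T S :: "'t set" and Y :: "'t \<Rightarrow> 'a \<Rightarrow> real"
    and p :: "(nat \<Rightarrow> 't set) \<Rightarrow> nat \<Rightarrow> 't \<Rightarrow> 't"
  assumes "sigma_finite_measure M"
    and "emeasure M (space M) = \<infinity>"
    and "diffuse_measure M"
    and "rearrangement_invariant_norm M \<rho>"
    and "T \<noteq> {}"
    and "\<And>t. t \<in> T \<Longrightarrow> Y t \<in> borel_measurable M"
    and "\<And>t. t \<in> T \<Longrightarrow> (\<lambda>x. ereal (Y t x)) \<in> fun_space M \<rho>"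
    and "separable_via M T Y S"
    and "dense_wrt (dG \<rho> Y) T S"
    and "\<And>W. generic_chaining \<rho> T Y S W \<Longrightarrow> nearest_selection (dG \<rho> Y) T W (p W)"
  shows "fun_norm \<rho> (\<lambda>x. SUP t\<in>T. ereal (Y t x))
           \<le> (INF W\<in>{W. generic_chaining \<rho> T Y S W}. chaining_sum \<rho> Y W (p W))"
proof -
  interpret rearrangement_invariant_norm M \<rho> by fact
  show ?thesis
  proof (rule INF_greatest)
    fix W assume "W \<in> {W. generic_chaining \<rho> T Y S W}"
    then have "generic_chaining \<rho> T Y S W" by simp
    with assms(5,6,8) show "fun_norm \<rho> (\<lambda>x. SUP t\<in>T. ereal (Y t x)) \<le> chaining_sum \<rho> Y W (p W)"
      by (intro norm_SUP_le_chaining_sum assms(10))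
  qed
qed

end
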